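(* Let $K\subsetneq L$ be a field extension with at least one proper nontrivial intermediate field of finite $K$-dimension (i.e. a field $F$ with $K\subsetneq F\subsetneq L$ and $[F:K]<\infty$). For each integer $n$ with $n_0(K,L)\le n<[L:K]$, we have $$\Delta(n)=\max_{\substack{m\in \mathcal{M}(K,L)\\ m\le n}}\Bigl(m-1-\bigl(n \bmod m\bigr)\Bigr).$$
   Context: Fields are commutative. All dimensions are over $K$. $[n]=\{1,\dots,n\}$, and $\langle X\rangle$ denotes the $K$-span of a set $X$. The degree $[L:K]$ may be infinite, in which case $n<[L:K]$ holds for every integer $n$. $n \bmod m$ denotes the remainder $r$ with $0\le r<m$ of $n$ upon division by $m$. Definition (partial matching of bases). Let $A,B$ be $n$-dimensional $K$-subspaces of $L$, $n\ge 1$, and $0\le d\le n$ an integer. An ordered basis $\mathcal{A}=\{a_1,\dots,a_n\}$ of $A$ is partially matched to an ordered basis $\mathcal{B}=\{b_1,\dots,b_n\}$ of $B$ with defect $d$ if there exists $P\subseteq[n]$ with $|P|=n-d$ such that $$a_i^{-1}A\cap B\subseteq \langle b_1,\dots,b_{i-1},b_{i+1},\dots,b_n\rangle\quad\text{for each } i\in P.$$ Definition (partial matching of subspaces). $A$ is partially matched to $B$ with defect $d$ if for every ordered basis $\mathcal{A}$ of $A$ there exists an ordered basis $\mathcal{B}$ of $B$ such that $\mathcal{A}$ is partially matched to $\mathcal{B}$ with defect $d$. Definition (deficiency). For $n$-dimensional $A,B$ with $0<n<\infty$ and $1\notin B$, $\delta(A,B)$ is the least nonnegative integer $d$ for which $A$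 is partially matched to $B$ with defect $d$. Definition ($\mathcal{M}$, $n_0$, $\Delta$). $\mathcal{M}(K,L)$ is the set of all degrees $[F:K]$, where $F$ is a proper nontrivial intermediate field ($K\subsetneq F\subsetneq L$) of finite $K$-dimension. $n_0(K,L)$ is the smallest degree $[F:K]$ over all intermediate fields $K\subsetneq F\subseteq L$ with $[F:K]<\infty$; under the present hypotheses it equals $\min\mathcal{M}(K,L)$. For each integer $n$ with $n_0(K,L)\le n<[L:K]$, $$\Delta(n)=\max_{A,B}\delta(A,B),$$ where $A,B$ run over all pairs of $K$-subspaces of $L$ with $\dim A=\dim B=n$ and $1\notin B$. *)

theory Defs
  imports "HOL-Algebra.Embedded_Algebras" "HOL-Library.Extended_Nat"
begin

text \<open>
  The large field of an extension is the field \<open>R\<close> of the locale, and the small field \<open>K\<close> is a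
  subfield of it, given as a set.  The notions \<open>Span\<close>, \<open>independent\<close>, \<open>dimension\<close> and \<open>dim\<close> over \<open>K\<close>
  are those of \<^theory>\<open>HOL-Algebra.Embedded_Algebras\<close>: there \<open>dimension n K A\<close> says that \<open>A\<close> is a
  \<open>K\<close>-subspace of dimension \<open>n\<close>.
  The members of an ordered basis are numbered \<open>0, \<dots>, n - 1\<close> instead of \<open>1, \<dots>, n\<close>.
\<close>

context field
begin

definition ext_degree :: "'a set \<Rightarrow> 'a set \<Rightarrow> enat"
  where "ext_degree K E = (if finite_dimension K E then enat ((dim over K) E) else \<infinity>)"

definition ordered_basis :: "'a set \<Rightarrow> 'a set \<Rightarrow> 'a list \<Rightarrow> bool"
  where "ordered_basis K A us \<longleftrightarrow> set us \<subseteq> carrier R \<and> independent K us \<and> Span K us = A"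

definition partially_matched_bases ::
    "'a set \<Rightarrow> 'a set \<Rightarrow> 'a set \<Rightarrow> 'a list \<Rightarrow> 'a list \<Rightarrow> nat \<Rightarrow> bool"
  where "partially_matched_bases K A B as bs d \<longleftrightarrow>
    d \<le> length as \<and>
    (\<exists>P \<subseteq> {..<length as}. card P = length as - d \<and>
      (\<forall>i\<in>P. (inv (as ! i) <# A) \<inter> B \<subseteq> Span K (take i bs @ drop (Suc i) bs)))"

definition partially_matched :: "'a set \<Rightarrow> 'a set \<Rightarrow> 'a set \<Rightarrow> nat \<Rightarrow> bool"
  where "partially_matched K A B d \<longleftrightarrow>
    (\<forall>as. ordered_basis K A as \<longrightarrow>
      (\<exists>bs. ordered_basis K B bs \<and> partially_matched_bases K A B as bs d))"

text \<open>
  If \<open>A\<close> and \<open>B\<close> have the same dimension \<open>n\<close>, then \<open>A\<close> is partially matched to \<open>B\<close> with defect \<open>n\<close>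
  (take \<open>P = {}\<close>), so the least defect exists and is at most \<open>n\<close>.
\<close>

definition deficiency :: "'a set \<Rightarrow> 'a set \<Rightarrow> 'a set \<Rightarrow> nat"
  where "deficiency K A B = (LEAST d. partially_matched K A B d)"

definition intermediate_degrees :: "'a set \<Rightarrow> nat set"
  where "intermediate_degrees K =
    {m. \<exists>F. subfield F R \<and> K \<subset> F \<and> F \<subset> carrier R \<and> dimension m K F}"

definition min_degree :: "'a set \<Rightarrow> nat"
  where "min_degree K =
    (LEAST m. \<exists>F. subfield F R \<and> K \<subset> F \<and> F \<subseteq> carrier R \<and> dimension m K F)"

text \<open>
  The deficiencies below are bounded by \<open>n\<close>, and there is at least one when \<open>n\<close> is smaller than the
  degree of the extension, so the maximum is that of a finite nonempty set.
\<close>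

definition max_deficiency :: "'a set \<Rightarrow> nat \<Rightarrow> nat"
  where "max_deficiency K n =
    Max {deficiency K A B | A B. dimension n K A \<and> dimension n K B \<and> \<one> \<notin> B}"

end

end

theory Submission
  imports Defs
begin

text \<open>
  A hyperplane of \<open>B\<close> is a functional up to scaling, so a basis of \<open>B\<close> partially matching
  \<open>a\<^sub>1, \<dots>, a\<^sub>n\<close> is a partial independent transversal of the annihilators of the spaces
  \<open>a\<^sub>i\<^sup>-\<^sup>1 A \<inter> B\<close>.  By Rado's theorem \<open>A\<close> is partially matched to \<open>B\<close> with defect \<open>d\<close> iff
  \<open>dim S + dim T \<le> n + d\<close> for all subspaces \<open>S \<subseteq> A\<close> and \<open>T \<subseteq> B\<close> with \<open>S T \<subseteq> A\<close>.

  Upper bound: the linear version of Olson's theorem, applied to \<open>S\<close> and \<open>T + K\<close> (a direct sum, as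
  \<open>1 \<notin> B\<close>), gives an intermediate field \<open>H\<close> of degree \<open>m\<close> and an \<open>H\<close>-subspace \<open>W \<subseteq> A\<close> with
  \<open>dim S + dim T + 1 \<le> dim W + m\<close>.  As \<open>dim W\<close> is a multiple of \<open>m\<close>, it is at most
  \<open>n - n mod m\<close>.

  Lower bound: for an intermediate field \<open>F\<close> of degree \<open>m\<close>, take for \<open>S\<close> an \<open>F\<close>-subspace of
  \<open>K\<close>-dimension \<open>n - n mod m\<close> and for \<open>T\<close> a \<open>K\<close>-hyperplane of \<open>F\<close> avoiding \<open>1\<close>.
\<close>

section \<open>Subspaces and dimension over a subfield\<close>

locale field_extension = field R for R (structure) +
  fixes K assumes K: "subfield K R"
begin

declare Span.simps [simp del]

abbreviation subspace :: "'a set \<Rightarrow> bool"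
  where "subspace V \<equiv> subalgebra K V R"

abbreviation fin_dim :: "'a set \<Rightarrow> bool"
  where "fin_dim V \<equiv> finite_dimension K V"

abbreviation dm :: "'a set \<Rightarrow> nat"
  where "dm V \<equiv> (dim over K) V"

lemma K_in_carrier: "K \<subseteq> carrier R"
  using subring_props[OF K] by blast

lemma subspaceD:
  assumes "subspace V"
  shows "V \<subseteq> carrier R" "\<zero> \<in> V"
    and "\<And>x y. x \<in> V \<Longrightarrow> y \<in> V \<Longrightarrow> x \<oplus> y \<in> V"
    and "\<And>x. x \<in> V \<Longrightarrow> \<ominus> x \<in> V"
    and "\<And>k x. k \<in> K \<Longrightarrow> x \<in> V \<Longrightarrow> k \<otimes> x \<in> V"
proof -
  interpret subalgebra K V R by fact
  show "V \<subseteq> carrier R" using subset by simp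
  show "\<zero> \<in> V" using one_closed by simp
  show "\<And>x y. x \<in> V \<Longrightarrow> y \<in> V \<Longrightarrow> x \<oplus> y \<in> V" using m_closed by simp
  show "\<And>x. x \<in> V \<Longrightarrow> \<ominus> x \<in> V" using m_inv_closed by (simp add: a_inv_def)
  show "\<And>k x. k \<in> K \<Longrightarrow> x \<in> V \<Longrightarrow> k \<otimes> x \<in> V" using smult_closed by simp
qed

lemma subspaceI:
  assumes "V \<subseteq> carrier R" "\<zero> \<in> V"
    and "\<And>x y. x \<in> V \<Longrightarrow> y \<in> V \<Longrightarrow> x \<oplus> y \<in> V"
    and "\<And>k x. k \<in> K \<Longrightarrow> x \<in> V \<Longrightarrow> k \<otimes> x \<in> V"
  shows "subspace V"
proof -
  have "\<ominus> x \<in> V" if "x \<in> V" for x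
  proof -
    have "\<ominus> \<one> \<otimes> x \<in> V" using assms(4) that subring_props[OF K] by blast
    moreover have "\<ominus> \<one> \<otimes> x = \<ominus> x" using that assms(1) by (simp add: subset_iff l_minus)
    ultimately show ?thesis by simp
  qed
  then have "subgroup V (add_monoid R)"
    using assms by (intro add.subgroupI) (auto simp: a_inv_def)
  then show ?thesis using assms(4) by (simp add: subalgebra_def subalgebra_axioms_def)
qed

lemma fin_dim_subspace: "fin_dim V \<Longrightarrow> subspace V"
  by (rule finite_dimension_imp_subalgebra[OF K])

text \<open>\<open>dm\<close> is total but meaningful only for finite-dimensional spaces; carrying
  \<open>fin_dim\<close> separately turns dimension arguments into arithmetic of natural
  numbers.\<close>

lemma dimension_iff: "dimension n K V \<longleftrightarrow> fin_dim V \<and> dm V = n"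
  using dimI[OF K] finite_dimensionE[OF K] finite_dimensionI by blast

lemma zero_space: "fin_dim {\<zero>}" "dm {\<zero>} = 0"
  using zero_dim dimension_iff by blast+

lemma dm_eq_0D: "fin_dim V \<Longrightarrow> dm V = 0 \<Longrightarrow> V = {\<zero>}"
  using dimension_zero dimension_iff K by blast

lemma fin_dim_mono: "fin_dim E \<Longrightarrow> subspace V \<Longrightarrow> V \<subseteq> E \<Longrightarrow> fin_dim V"
  by (rule subalbegra_incl_imp_finite_dimension[OF K])

lemma obtain_basis:
  assumes "fin_dim V"
  obtains us where "set us \<subseteq> carrier R" "independent K us" "length us = dm V" "Span K us = V"
  using exists_base[OF K] assms dimension_iff by metis

lemma independent_dm:
  assumes "independent K us"
  shows "fin_dim (Span K us)" "dm (Span K us) = length us"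
  using dimension_independent[OF assms] dimension_iff by auto

lemma dm_mono:
  assumes "fin_dim E" "subspace V" "V \<subseteq> E"
  shows "dm V \<le> dm E"
proof -
  obtain us where us: "set us \<subseteq> carrier R" "independent K us" "length us = dm V" "Span K us = V"
    using obtain_basis[OF fin_dim_mono[OF assms]] .
  have "set us \<subseteq> E" using Span_base_incl[OF K us(1)] us(4) assms(3) by simp
  then show ?thesis using independent_length_le_dimension[OF K _ us(2)] us(3) assms(1) dimension_iff
    by metis
qed

lemma dm_eqD:
  assumes "fin_dim E" "subspace V" "V \<subseteq> E" "dm E \<le> dm V"
  shows "V = E"
proof -
  obtain us where us: "set us \<subseteq> carrier R" "independent K us" "length us = dm V" "Span K us = V"
    using obtain_basis[OF fin_dim_mono[OF assms(1-3)]] .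
  have "set us \<subseteq> E" using Span_base_incl[OF K us(1)] us(4) assms(3) by simp
  moreover have "dm V = dm E" using dm_mono[OF assms(1-3)] assms(4) by simp
  ultimately show ?thesis
    using independent_length_eq_dimension[OF K _ us(2)] us assms(1) dimension_iff by metis
qed

lemma sum_subspace:
  assumes "subspace V" "subspace W"
  shows "subspace (V <+>\<^bsub>R\<^esub> W)" "V \<subseteq> V <+>\<^bsub>R\<^esub> W" "W \<subseteq> V <+>\<^bsub>R\<^esub> W"
proof -
  note V = subspaceD[OF assms(1)] and W = subspaceD[OF assms(2)]
  note c = subsetD[OF V(1)] subsetD[OF W(1)] subsetD[OF K_in_carrier]
  have mem: "x \<in> V <+>\<^bsub>R\<^esub> W \<longleftrightarrow> (\<exists>v\<in>V. \<exists>w\<in>W. x = v \<oplus> w)" for x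
    by (auto simp: set_add_def')
  show "subspace (V <+>\<^bsub>R\<^esub> W)"
  proof (rule subspaceI)
    show "V <+>\<^bsub>R\<^esub> W \<subseteq> carrier R" using c by (auto simp: mem)
    show "\<zero> \<in> V <+>\<^bsub>R\<^esub> W" unfolding mem using V(2) W(2) by force
  next
    fix x y assume "x \<in> V <+>\<^bsub>R\<^esub> W" "y \<in> V <+>\<^bsub>R\<^esub> W"
    then obtain v w v' w' where
      *: "v \<in> V" "w \<in> W" "x = v \<oplus> w" "v' \<in> V" "w' \<in> W" "y = v' \<oplus> w'"
      unfolding mem by blast
    have "x \<oplus> y = (v \<oplus> v') \<oplus> (w \<oplus> w')" using * c by (simp add: a_ac)
    then show "x \<oplus> y \<in> V <+>\<^bsub>R\<^esub> W" unfolding mem using * V(3) W(3) by blast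
  next
    fix k x assume k: "k \<in> K" and "x \<in> V <+>\<^bsub>R\<^esub> W"
    then obtain v w where *: "v \<in> V" "w \<in> W" "x = v \<oplus> w" unfolding mem by blast
    have "k \<otimes> x = k \<otimes> v \<oplus> k \<otimes> w" using * c k by (simp add: r_distr)
    then show "k \<otimes> x \<in> V <+>\<^bsub>R\<^esub> W" unfolding mem using * k V(5) W(5) by blast
  qed
  show "V \<subseteq> V <+>\<^bsub>R\<^esub> W"
  proof
    fix x assume "x \<in> V"
    then show "x \<in> V <+>\<^bsub>R\<^esub> W" unfolding mem using W(2) c by (metis r_zero)
  qed
  show "W \<subseteq> V <+>\<^bsub>R\<^esub> W"
  proof
    fix x assume "x \<in> W"
    then show "x \<in> V <+>\<^bsub>R\<^esub> W" unfolding mem using V(2) c by (metis l_zero)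
  qed
qed

lemma sum_least:
  assumes "subspace U" "V \<subseteq> U" "W \<subseteq> U"
  shows "V <+>\<^bsub>R\<^esub> W \<subseteq> U"
  using assms(2,3) subspaceD(3)[OF assms(1)] by (auto simp: set_add_def')

lemma dm_sum_inter:
  assumes "fin_dim V" "fin_dim W"
  shows "fin_dim (V <+>\<^bsub>R\<^esub> W)" "dm (V <+>\<^bsub>R\<^esub> W) + dm (V \<inter> W) = dm V + dm W"
proof -
  \<comment> \<open>This bound makes the truncated subtraction in \<open>sum_space_dim\<close>
    exact.\<close>
  have "dm (V \<inter> W) \<le> dm V"
    using assms fin_dim_subspace subalgebra_inter by (intro dm_mono) auto
  then show "fin_dim (V <+>\<^bsub>R\<^esub> W)" "dm (V <+>\<^bsub>R\<^esub> W) + dm (V \<inter> W) = dm V + dm W"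
    using sum_space_dim[OF K assms] by simp_all
qed

lemma dm_inter_ge:
  assumes "fin_dim E" "subspace V" "subspace W" "V \<subseteq> E" "W \<subseteq> E"
  shows "dm V + dm W \<le> dm E + dm (V \<inter> W)"
proof -
  have "dm (V <+>\<^bsub>R\<^esub> W) \<le> dm E"
    using assms sum_subspace sum_least fin_dim_subspace by (intro dm_mono) auto
  then show ?thesis using dm_sum_inter(2)[of V W] fin_dim_mono assms by fastforce
qed

lemma line_extension_fin_dim:
  assumes "fin_dim V" "x \<in> carrier R" "x \<notin> V"
  shows "fin_dim (line_extension K x V)" "dm (line_extension K x V) = Suc (dm V)"
  using Suc_dim[OF assms(2,3)] assms(1) dimension_iff by blast+

lemma line_extension_incl:
  assumes "subspace V" "x \<in> carrier R"
  shows "V \<subseteq> line_extension K x V" "x \<in> line_extension K x V"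
proof -
  note V = subspaceD[OF assms(1)]
  show "V \<subseteq> line_extension K x V"
  proof
    fix v assume "v \<in> V"
    then have "v = \<zero> \<otimes> x \<oplus> v" using V(1) assms(2) by auto
    then show "v \<in> line_extension K x V"
      unfolding line_extension_mem_iff using \<open>v \<in> V\<close> subring_props[OF K] by blast
  qed
  have "x = \<one> \<otimes> x \<oplus> \<zero>" using assms(2) by simp
  then show "x \<in> line_extension K x V"
    unfolding line_extension_mem_iff using V(2) subring_props[OF K] by blast
qed

lemma line_extension_least:
  assumes "subspace E" "V \<subseteq> E" "x \<in> E"
  shows "line_extension K x V \<subseteq> E"
  using subspaceD(3,5)[OF assms(1)] assms(2,3) unfolding line_extension_mem_iff subset_iff by blast

text \<open>Vectors of \<open>E\<close> are adjoined one at a time. The bound on \<open>k\<close> is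
  conditional because an infinite-dimensional \<open>E\<close> always leaves room; extensions of
  infinite degree are thus covered by the same argument.\<close>

lemma exists_between:
  assumes "subspace E" "fin_dim V" "V \<subseteq> E" "dm V \<le> k" "fin_dim E \<Longrightarrow> k \<le> dm E"
  shows "\<exists>W. fin_dim W \<and> V \<subseteq> W \<and> W \<subseteq> E \<and> dm W = k"
  using assms(4,5)
proof (induction k rule: dec_induct)
  case base
  then show ?case using assms(2,3) by blast
next
  case (step k)
  obtain W where W: "fin_dim W" "V \<subseteq> W" "W \<subseteq> E" "dm W = k"
    using step by fastforce
  have "W \<noteq> E" using W step.prems by force
  then obtain x where x: "x \<in> E" "x \<notin> W" using W by blast
  then have "x \<in> carrier R" using subspaceD(1)[OF assms(1)] by blast
  with line_extension_fin_dim[OF W(1) this x(2)] line_extension_incl[OF fin_dim_subspace[OF W(1)] this]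
    line_extension_least[OF assms(1) W(3) x(1)] W
  show ?case by (intro exI[of _ "line_extension K x W"]) auto
qed

text \<open>A basis of \<open>T\<close> is extended by \<open>x\<close> and then to a basis of
  \<open>W\<close>; all of that basis except \<open>x\<close> spans the hyperplane.\<close>

lemma exists_hyperplane_avoiding:
  assumes "fin_dim W" "subspace T" "T \<subseteq> W" "x \<in> W" "x \<notin> T"
  shows "\<exists>H. fin_dim H \<and> T \<subseteq> H \<and> H \<subseteq> W \<and> x \<notin> H \<and> Suc (dm H) = dm W"
proof -
  obtain us where us: "set us \<subseteq> carrier R" "independent K us" "length us = dm T" "Span K us = T"
    using obtain_basis[OF fin_dim_mono[OF assms(1-3)]] .
  have Wc: "W \<subseteq> carrier R" by (rule subspaceD(1)[OF fin_dim_subspace[OF assms(1)]])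
  have ind: "independent K (x # us)" using us assms(4,5) Wc by (intro li_Cons) auto
  have "set (x # us) \<subseteq> W" using Span_base_incl[OF K us(1)] us(4) assms(3,4) by auto
  from complete_base[OF K _ ind this, of "dm W"] obtain vs where
    vs: "length (vs @ x # us) = dm W" "independent K (vs @ x # us)" "Span K (vs @ x # us) = W"
    using assms(1) dimension_iff by blast
  have c: "set (vs @ x # us) \<subseteq> carrier R" using independent_in_carrier[OF vs(2)] .
  have ind': "independent K (x # (vs @ us))"
    by (rule independent_same_set[OF K _ _ vs(2)]) auto
  have i2: "independent K (vs @ us)" "x \<notin> Span K (vs @ us)"
    using independent_backwards[OF ind'] by auto
  have "Span K (vs @ us) \<subseteq> W" using mono_Span_sublist[OF K _ c, of "vs @ us"] vs(3) by auto
  moreover have "T \<subseteq> Span K (vs @ us)" using mono_Span_append(2)[OF K us(1), of vs] us(4) c by auto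
  ultimately show ?thesis using independent_dm[OF i2(1)] i2(2) vs(1)
    by (intro exI[of _ "Span K (vs @ us)"]) auto
qed

section \<open>Rado's theorem with defect, in dual form\<close>

text \<open>For finite-dimensional \<open>B\<close> this is the common kernel of the annihilators of
  the spaces \<open>U i \<inter> B\<close> in the dual of \<open>B\<close>. The factor
  \<open>B\<close> gives the value \<open>B\<close> at \<open>J = {}\<close>.\<close>

definition meet :: "'a set \<Rightarrow> ('i \<Rightarrow> 'a set) \<Rightarrow> 'i set \<Rightarrow> 'a set"
  where "meet B U J = B \<inter> (\<Inter>i\<in>J. U i)"

text \<open>Rado's condition with defect \<open>e\<close>, stated for the annihilators of the subspaces \<open>U i\<close> in the
  dual space of \<open>B\<close>.\<close>

definition rado_condition :: "'a set \<Rightarrow> ('i \<Rightarrow> 'a set) \<Rightarrow> 'i set \<Rightarrow> nat \<Rightarrow> bool"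
  where "rado_condition B U N e \<longleftrightarrow> (\<forall>J\<subseteq>N. dm (meet B U J) + card J \<le> dm B + e)"

lemma rado_conditionD:
  "rado_condition B U N e \<Longrightarrow> J \<subseteq> N \<Longrightarrow> dm (meet B U J) + card J \<le> dm B + e"
  by (simp add: rado_condition_def)

lemma subspace_meet:
  assumes "subspace B" "\<And>i. i \<in> J \<Longrightarrow> subspace (U i)"
  shows "subspace (meet B U J)"
proof (rule subspaceI)
  note B = subspaceD[OF assms(1)] and U = subspaceD[OF assms(2)]
  show "meet B U J \<subseteq> carrier R" using B(1) by (auto simp: meet_def)
  show "\<zero> \<in> meet B U J" using B(2) U(2) by (auto simp: meet_def)
  show "x \<oplus> y \<in> meet B U J" if "x \<in> meet B U J" "y \<in> meet B U J" for x y
    using that B(3) U(3) by (auto simp: meet_def)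
  show "k \<otimes> x \<in> meet B U J" if "k \<in> K" "x \<in> meet B U J" for k x
    using that B(5) U(5) by (auto simp: meet_def)
qed

lemma fin_dim_meet:
  assumes "fin_dim B" "\<And>i. i \<in> J \<Longrightarrow> subspace (U i)"
  shows "fin_dim (meet B U J)"
  using subspace_meet[OF fin_dim_subspace[OF assms(1)] assms(2)]
  by (rule fin_dim_mono[OF assms(1)]) (auto simp: meet_def)

lemma meet_insert: "meet B U (insert k J) = meet B U J \<inter> U k"
  by (auto simp: meet_def)

lemma meet_upd: "k \<notin> J \<Longrightarrow> meet B (U(k := Y)) J = meet B U J"
  by (force simp: meet_def)

text \<open>A change at \<open>k\<close> affects only index sets that contain \<open>k\<close>.
  Removing \<open>k\<close> from a violating set lowers its cardinality by one, which turns the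
  strict violation into \<open>\<le>\<close>.\<close>

lemma rado_condition_violated:
  assumes "rado_condition B U N e" "\<not> rado_condition B (U(k := Y)) N e" "finite N"
  obtains J where "J \<subseteq> N" "k \<notin> J" "dm B + e \<le> dm (meet B U J \<inter> Y) + card J"
proof -
  obtain J where J: "J \<subseteq> N" "dm (meet B (U(k := Y)) J) + card J > dm B + e"
    using assms(2) by (force simp: rado_condition_def)
  have "k \<in> J"
  proof (rule ccontr)
    assume "k \<notin> J"
    then show False using J meet_upd[of k J B U Y] rado_conditionD[OF assms(1) J(1)] by simp
  qed
  then have "meet B (U(k := Y)) J = meet B U (J - {k}) \<inter> Y"
    using meet_insert[of B "U(k := Y)" k "J - {k}"] meet_upd[of k "J - {k}" B U Y]
    by (simp add: insert_absorb)
  moreover have "card J = Suc (card (J - {k}))"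
    by (rule card.remove[OF finite_subset[OF J(1) assms(3)] \<open>k \<in> J\<close>])
  ultimately show thesis using J by (intro that[of "J - {k}"]) auto
qed

text \<open>Submodularity of the dimension: the two violating index sets would be combined into their
  union, with \<open>Y \<inter> Z\<close>, and their intersection.\<close>

lemma rado_condition_one_of_two:
  assumes "fin_dim B" "finite N" "k \<in> N" "\<And>i. i \<in> N \<Longrightarrow> subspace (U i)"
    and "rado_condition B U N e" "subspace Y" "subspace Z" "Y \<inter> Z = U k"
  shows "rado_condition B (U(k := Y)) N e \<or> rado_condition B (U(k := Z)) N e"
proof (rule ccontr)
  assume "\<not> ?thesis"
  then obtain J J' where
    J: "J \<subseteq> N" "k \<notin> J" "dm B + e \<le> dm (meet B U J \<inter> Y) + card J" and
    J': "J' \<subseteq> N" "k \<notin> J'" "dm B + e \<le> dm (meet B U J' \<inter> Z) + card J'"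
    using rado_condition_violated[OF assms(5) _ assms(2)] by metis
  have fin: "finite J" "finite J'" using J(1) J'(1) assms(2) finite_subset by auto
  let ?P = "meet B U J \<inter> Y" and ?Q = "meet B U J' \<inter> Z"
  have sub: "subspace (meet B U I)" if "I \<subseteq> N" for I
    using that subspace_meet[OF fin_dim_subspace[OF assms(1)]] assms(4) by blast
  have PQ: "subspace ?P" "subspace ?Q"
    using sub J(1) J'(1) assms(6,7) subalgebra_inter by auto
  have PQB: "?P \<subseteq> B" "?Q \<subseteq> B" by (auto simp: meet_def)
  have fPQ: "fin_dim ?P" "fin_dim ?Q" using fin_dim_mono[OF assms(1)] PQ PQB by auto
  \<comment> \<open>Since \<open>Y \<inter> Z = U k\<close>, the index \<open>k\<close> may be
    adjoined to the union; it supplies the one unit that yields the contradiction.\<close>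
  have "?P \<inter> ?Q = (meet B U J \<inter> meet B U J') \<inter> (Y \<inter> Z)" by blast
  also have "\<dots> = meet B U (insert k (J \<union> J'))" using assms(8) by (auto simp: meet_def)
  finally have inter: "?P \<inter> ?Q = meet B U (insert k (J \<union> J'))" .
  have "insert k (J \<union> J') \<subseteq> N" using J(1) J'(1) assms(3) by auto
  moreover have "card (insert k (J \<union> J')) = Suc (card (J \<union> J'))"
    using J(2) J'(2) fin by simp
  ultimately have 1: "dm (?P \<inter> ?Q) + Suc (card (J \<union> J')) \<le> dm B + e"
    using rado_conditionD[OF assms(5)] inter by metis
  have JJ: "J \<inter> J' \<subseteq> N" using J(1) by auto
  have "?P \<subseteq> meet B U (J \<inter> J')" "?Q \<subseteq> meet B U (J \<inter> J')" by (auto simp: meet_def)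
  note PQJ = sum_least[OF sub[OF JJ] this]
  have "fin_dim (meet B U (J \<inter> J'))"
    using JJ assms(4) by (intro fin_dim_meet[OF assms(1)]) auto
  then have "dm (?P <+>\<^bsub>R\<^esub> ?Q) \<le> dm (meet B U (J \<inter> J'))"
    using sum_subspace(1)[OF PQ] PQJ by (rule dm_mono)
  then have 2: "dm (?P <+>\<^bsub>R\<^esub> ?Q) + card (J \<inter> J') \<le> dm B + e"
    using rado_conditionD[OF assms(5) JJ] by linarith
  \<comment> \<open>The two violations add up to at least twice \<open>dm B + e\<close>. By
    modularity of dimension and cardinality, \<open>1\<close> and \<open>2\<close> bound the same
    total by one less.\<close>
  show False
    using 1 2 J(3) J'(3) dm_sum_inter(2)[OF fPQ] card_Un_Int[OF fin] by linarith
qed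

text \<open>Codimension at least two leaves room for two vectors of \<open>B\<close> that are
  independent modulo \<open>V\<close>; \<open>Y\<close> and \<open>Z\<close> arise by adjoining one
  of them each.\<close>

lemma subspace_eq_inter:
  assumes "fin_dim B" "subspace V" "V \<subseteq> B" "Suc (dm V) < dm B"
  obtains Y Z where "fin_dim Y" "fin_dim Z" "V \<subset> Y" "V \<subset> Z" "Y \<subseteq> B" "Z \<subseteq> B" "Y \<inter> Z = V"
proof -
  have fV: "fin_dim V" by (rule fin_dim_mono[OF assms(1-3)])
  have sB: "subspace B" by (rule fin_dim_subspace[OF assms(1)])
  have "V \<noteq> B" using assms(4) by auto
  then obtain y where y: "y \<in> B" "y \<notin> V" using assms(3) by blast
  have yc: "y \<in> carrier R" using y(1) subspaceD(1)[OF sB] by blast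
  let ?Y = "line_extension K y V"
  note Y = line_extension_fin_dim[OF fV yc y(2)] line_extension_incl[OF assms(2) yc]
    line_extension_least[OF sB assms(3) y(1)]
  have "?Y \<noteq> B" using assms(4) Y(2) by auto
  then obtain z where z: "z \<in> B" "z \<notin> ?Y" using Y(5) by blast
  have zc: "z \<in> carrier R" using z(1) subspaceD(1)[OF sB] by blast
  have zV: "z \<notin> V" using z(2) Y(3) by blast
  let ?Z = "line_extension K z V"
  note Z = line_extension_fin_dim[OF fV zc zV] line_extension_incl[OF assms(2) zc]
    line_extension_least[OF sB assms(3) z(1)]
  have sYZ: "subspace (?Y \<inter> ?Z)" using fin_dim_subspace Y(1) Z(1) subalgebra_inter by blast
  have "dm (?Y \<inter> ?Z) \<le> dm ?Z" by (rule dm_mono[OF Z(1) sYZ]) auto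
  moreover have "dm (?Y \<inter> ?Z) \<noteq> dm ?Z"
    using dm_eqD[OF Z(1) sYZ] Z(4) z(2) by auto
  ultimately have "dm (?Y \<inter> ?Z) \<le> dm V" using Z(2) by simp
  then have "V = ?Y \<inter> ?Z"
    using Y(3) Z(3) fin_dim_mono[OF Y(1) sYZ] by (intro dm_eqD[OF _ assms(2)]) auto
  then show thesis using Y Z y(2) zV by (intro that[of ?Y ?Z]) blast+
qed

text \<open>Dually, the annihilator of \<open>U k\<close> shrinks to a line or to zero while Rado's
  condition survives: in codimension at least two \<open>U k\<close> is the intersection of two
  larger subspaces, and one of them may replace it.\<close>

lemma rado_enlarge_one:
  assumes "fin_dim B" "finite N" "k \<in> N" "\<And>i. i \<in> N \<Longrightarrow> subspace (U i)"
    and "rado_condition B U N e" "U k \<subseteq> B"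
  shows "\<exists>V. subspace V \<and> U k \<subseteq> V \<and> V \<subseteq> B \<and> dm B \<le> Suc (dm V) \<and>
    rado_condition B (U(k := V)) N e"
  using assms(4-6)
proof (induction "dm B - dm (U k)" arbitrary: U rule: less_induct)
  case less
  have sk: "subspace (U k)" using less.prems(1) assms(3) by blast
  show ?case
  proof (cases "dm B \<le> Suc (dm (U k))")
    case True
    then show ?thesis using less.prems sk by (intro exI[of _ "U k"]) auto
  next
    case False
    have step: ?thesis
      if Y: "fin_dim Y" "U k \<subset> Y" "Y \<subseteq> B" and cond: "rado_condition B (U(k := Y)) N e" for Y
    proof -
      have sY: "subspace Y" by (rule fin_dim_subspace[OF Y(1)])
      have "dm (U k) < dm Y"
        using dm_mono[OF Y(1) sk] dm_eqD[OF Y(1) sk] Y(2) by (metis linorder_not_le psubsetE)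
      then have "dm B - dm ((U(k := Y)) k) < dm B - dm (U k)" using False by simp
      moreover have "subspace ((U(k := Y)) i)" if "i \<in> N" for i
        using that sY less.prems(1) by simp
      ultimately obtain V where
        "subspace V" "Y \<subseteq> V" "V \<subseteq> B" "dm B \<le> Suc (dm V)" "rado_condition B (U(k := V)) N e"
        using less.hyps[OF _ _ cond] Y(3) by auto
      then show ?thesis using Y(2) by blast
    qed
    from False have "Suc (dm (U k)) < dm B" by simp
    from subspace_eq_inter[OF assms(1) sk less.prems(3) this] obtain Y Z where
      YZ: "fin_dim Y" "fin_dim Z" "U k \<subset> Y" "U k \<subset> Z" "Y \<subseteq> B" "Z \<subseteq> B" "Y \<inter> Z = U k" .
    have "rado_condition B (U(k := Y)) N e \<or> rado_condition B (U(k := Z)) N e"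
      using rado_condition_one_of_two[OF assms(1-3) less.prems(1,2)] YZ fin_dim_subspace by blast
    then show ?thesis using step YZ by blast
  qed
qed

text \<open>The indices are treated one after another; \<open>M\<close> collects those already
  done.\<close>

lemma rado_enlarge:
  assumes "fin_dim B" "finite N" "\<And>i. i \<in> N \<Longrightarrow> subspace (U i) \<and> U i \<subseteq> B"
    and "rado_condition B U N e" "M \<subseteq> N"
  shows "\<exists>V. (\<forall>i\<in>N. subspace (V i) \<and> U i \<subseteq> V i \<and> V i \<subseteq> B) \<and>
    (\<forall>i\<in>M. dm B \<le> Suc (dm (V i))) \<and> rado_condition B V N e"
  using finite_subset[OF assms(5,2)] assms(5)
proof (induction M rule: finite_induct)
  case empty
  then show ?case using assms(3,4) by blast
next
  case (insert k M)
  then obtain V where V: "\<forall>i\<in>N. subspace (V i) \<and> U i \<subseteq> V i \<and> V i \<subseteq> B"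
    "\<forall>i\<in>M. dm B \<le> Suc (dm (V i))" "rado_condition B V N e" by auto
  from insert.prems V(1) rado_enlarge_one[OF assms(1,2) _ _ V(3), of k] obtain W where
    "subspace W" "V k \<subseteq> W" "W \<subseteq> B" "dm B \<le> Suc (dm W)" "rado_condition B (V(k := W)) N e"
    by auto
  moreover from this V(1,2) have
    "\<forall>i\<in>N. subspace ((V(k := W)) i) \<and> U i \<subseteq> (V(k := W)) i \<and> (V(k := W)) i \<subseteq> B"
    "\<forall>i\<in>insert k M. dm B \<le> Suc (dm ((V(k := W)) i))" by auto
  ultimately show ?case by blast
qed

text \<open>Each \<open>U i\<close> is the kernel of a functional on \<open>B\<close>, possibly
  zero, and \<open>P\<close> picks a basis of the span of these functionals: an index is kept when
  its kernel cuts the current intersection, which then loses exactly one dimension.\<close>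

lemma meet_exact_subset:
  assumes "fin_dim B" "finite N" "\<And>i. i \<in> N \<Longrightarrow> subspace (U i) \<and> U i \<subseteq> B \<and> dm B \<le> Suc (dm (U i))"
  shows "\<exists>P\<subseteq>N. meet B U P = meet B U N \<and> dm (meet B U P) + card P = dm B"
  using assms(2,3)
proof (induction N rule: finite_induct)
  case empty
  then show ?case by (simp add: meet_def)
next
  case (insert k N)
  then obtain P where P: "P \<subseteq> N" "meet B U P = meet B U N" "dm (meet B U P) + card P = dm B"
    by auto
  let ?X = "meet B U P"
  have U: "subspace (U k)" "U k \<subseteq> B" "dm B \<le> Suc (dm (U k))" using insert.prems by auto
  have X: "fin_dim ?X" using P(1) insert.prems by (intro fin_dim_meet[OF assms(1)]) auto
  show ?case
  proof (cases "?X \<subseteq> U k")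
    case True
    then have "meet B U (insert k N) = meet B U P" unfolding meet_insert using P(2) by auto
    then show ?thesis using P by (intro exI[of _ P]) auto
  next
    case False
    have s: "subspace (?X \<inter> U k)" using fin_dim_subspace[OF X] U(1) subalgebra_inter by blast
    have "dm (?X \<inter> U k) \<le> dm ?X" by (rule dm_mono[OF X s]) auto
    moreover have "dm (?X \<inter> U k) \<noteq> dm ?X" using dm_eqD[OF X s] False by auto
    moreover have "dm ?X + dm (U k) \<le> dm B + dm (?X \<inter> U k)"
      using U fin_dim_subspace[OF X] by (intro dm_inter_ge[OF assms(1)]) (auto simp: meet_def)
    ultimately have "Suc (dm (?X \<inter> U k)) = dm ?X" using U(3) by simp
    moreover have "k \<notin> P" "finite P" using P(1) insert.hyps finite_subset by auto
    ultimately show ?thesis using P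
      by (intro exI[of _ "insert k P"]) (auto simp: meet_insert)
  qed
qed

text \<open>Each \<open>b i\<close> lies outside \<open>U i\<close>, which contains every vector
  after it in the list, so prepending \<open>b i\<close> preserves independence.\<close>

lemma independent_append_separated:
  assumes "independent K cs" "distinct is" "\<And>i. i \<in> set is \<Longrightarrow> subspace (U i)"
    and "\<And>i. i \<in> set is \<Longrightarrow> set cs \<subseteq> U i"
    and "\<And>i. i \<in> set is \<Longrightarrow> b i \<in> carrier R \<and> b i \<notin> U i"
    and "\<And>i j. i \<in> set is \<Longrightarrow> j \<in> set is \<Longrightarrow> i \<noteq> j \<Longrightarrow> b j \<in> U i"
  shows "independent K (map b is @ cs)"
  using assms(2-6)
proof (induction "is")
  case Nil
  then show ?case using assms(1) by simp
next
  case (Cons i js)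
  have "set (map b js @ cs) \<subseteq> U i" using Cons.prems(1,3,5) by fastforce
  then have "Span K (map b js @ cs) \<subseteq> U i"
    using subalgebra_Span_incl[OF K] Cons.prems(2) by simp
  then show ?case using Cons by (auto intro!: li_Cons)
qed

lemma set_take_drop:
  assumes "i < length xs"
  shows "set (take i xs @ drop (Suc i) xs) = (!) xs ` ({..<length xs} - {i})"
proof -
  have "set (take i xs) = (!) xs ` {0..<i}" using assms by (simp add: nth_image)
  moreover have "set (drop (Suc i) xs) = (!) xs ` {Suc i..<length xs}"
    by (subst map_nth[of xs, symmetric]) (simp only: drop_map drop_upt set_map, simp)
  moreover have "{0..<i} \<union> {Suc i..<length xs} = {..<length xs} - {i}" using assms by auto
  ultimately show ?thesis by (metis image_Un set_append)
qed

lemma independent_remove_nth: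
  assumes "independent K xs" "i < length xs"
  shows "independent K (take i xs @ drop (Suc i) xs)" "xs ! i \<notin> Span K (take i xs @ drop (Suc i) xs)"
proof -
  have "independent K (take i xs @ xs ! i # drop (Suc i) xs)"
    using assms by (simp flip: id_take_nth_drop)
  then have "independent K (xs ! i # (take i xs @ drop (Suc i) xs))"
    by (rule independent_same_set[OF K, rotated 2]) auto
  then show "independent K (take i xs @ drop (Suc i) xs)"
    "xs ! i \<notin> Span K (take i xs @ drop (Suc i) xs)"
    using independent_backwards by auto
qed

text \<open>After the spaces \<open>U i\<close> have grown to kernels of functionals, a maximal
  independent set \<open>P\<close> of functionals is selected. The basis of \<open>B\<close> has a
  dual system at the positions in \<open>P\<close> and a basis of the common kernel at the
  others.\<close>

lemma rado_basis:
  assumes "fin_dim B" "\<And>i. i < dm B \<Longrightarrow> subspace (U i) \<and> U i \<subseteq> B"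
    and "rado_condition B U {..<dm B} e"
  shows "\<exists>bs P. ordered_basis K B bs \<and> P \<subseteq> {..<dm B} \<and> card P = dm B - e \<and>
    (\<forall>i\<in>P. U i \<subseteq> Span K (take i bs @ drop (Suc i) bs))"
proof -
  define n where "n = dm B"
  have Bc: "B \<subseteq> carrier R" by (rule subspaceD(1)[OF fin_dim_subspace[OF assms(1)]])
  obtain V where V: "\<forall>i\<in>{..<n}. subspace (V i) \<and> U i \<subseteq> V i \<and> V i \<subseteq> B"
    "\<forall>i\<in>{..<n}. n \<le> Suc (dm (V i))" "rado_condition B V {..<n} e"
    using rado_enlarge[OF assms(1), of "{..<n}" U e "{..<n}"] assms(2,3) n_def by auto
  have exact: "\<exists>P\<subseteq>N. meet B V P = meet B V N \<and> dm (meet B V P) + card P = n"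
    if "N \<subseteq> {..<n}" for N
    unfolding n_def
  proof (rule meet_exact_subset[OF assms(1)])
    show "finite N" using that finite_subset by auto
    show "\<And>i. i \<in> N \<Longrightarrow> subspace (V i) \<and> V i \<subseteq> B \<and> dm B \<le> Suc (dm (V i))"
      using V(1,2) that n_def by blast
  qed
  obtain P where P: "P \<subseteq> {..<n}" "meet B V P = meet B V {..<n}" "dm (meet B V P) + card P = n"
    using exact[of "{..<n}"] by auto
  have fP: "finite P" using P(1) finite_subset by auto
  \<comment> \<open>Rado's condition for the full index set bounds the dimension of the common
    kernel by \<open>e\<close>, so at most \<open>e\<close> positions fall outside
    \<open>P\<close>.\<close>
  have "dm (meet B V {..<n}) + n \<le> n + e"
    using rado_conditionD[OF V(3), of "{..<n}"] n_def by simp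
  then have cardP: "n - e \<le> card P" using P(2,3) by simp
  \<comment> \<open>Independence of the selected functionals: if \<open>i\<close> were redundant, an
    exact \<open>Q\<close> inside \<open>P - {i}\<close> would have as many members as
    \<open>P\<close>.\<close>
  have "\<exists>x. x \<in> meet B V (P - {i}) \<and> x \<notin> V i" if "i \<in> P" for i
  proof (rule ccontr)
    assume "\<not> ?thesis"
    then have "meet B V (P - {i}) \<subseteq> V i" by blast
    then have "meet B V (P - {i}) = meet B V P"
      using meet_insert[of B V i "P - {i}"] that by (auto simp: insert_absorb)
    moreover obtain Q where Q: "Q \<subseteq> P - {i}" "meet B V Q = meet B V (P - {i})"
      "dm (meet B V Q) + card Q = n" using exact[of "P - {i}"] P(1) by blast
    ultimately have "card Q = card P" using P(3) by simp
    moreover have "card Q < card P" using Q(1) that fP by (intro psubset_card_mono) auto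
    ultimately show False by simp
  qed
  then obtain p where p: "p i \<in> meet B V (P - {i})" "p i \<notin> V i" if "i \<in> P" for i
    by metis
  have C: "fin_dim (meet B V P)" using V(1) P(1) by (intro fin_dim_meet[OF assms(1)]) auto
  obtain cs where cs: "set cs \<subseteq> carrier R" "independent K cs" "length cs = dm (meet B V P)"
    "Span K cs = meet B V P" using obtain_basis[OF C] .
  have csP: "set cs \<subseteq> meet B V P" using Span_base_incl[OF K cs(1)] cs(4) by simp
  \<comment> \<open>The positions \<open>js\<close> outside \<open>P\<close> are as many as the
    vectors \<open>cs\<close>, which fill them by means of the lookup function
    \<open>f\<close>.\<close>
  define "is" where "is = sorted_list_of_set P"
  define js where "js = sorted_list_of_set ({..<n} - P)"
  have ij: "set is = P" "distinct is" "length is = card P" "set js = {..<n} - P" "distinct js"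
    "length js = length cs"
    using fP P cs(3) card_Diff_subset[OF fP P(1)] by (auto simp: is_def js_def)
  have "\<exists>f. map f js = cs"
  proof
    show "map (\<lambda>j. the (map_of (zip js cs) j)) js = cs"
      using ij(5,6) by (intro nth_equalityI) (auto simp: map_of_zip_nth)
  qed
  then obtain f where f: "map f js = cs" by blast
  define b where "b i = (if i \<in> P then p i else f i)" for i
  have "map b js = map f js" using ij(4) by (auto simp: b_def)
  then have bjs: "map b js = cs" using f by metis
  have bP: "b i \<in> B" "b i \<notin> V i" if "i \<in> P" for i
    using p[OF that] that by (auto simp: b_def meet_def)
  have bB: "b i \<in> B" if "i < n" for i
  proof (cases "i \<in> P")
    case False
    then have "b i \<in> set cs" using that ij(4) unfolding bjs[symmetric] by simp
    then show ?thesis using csP by (auto simp: meet_def)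
  qed (rule bP)
  have bV: "b j \<in> V i" if "i \<in> P" "j < n" "j \<noteq> i" for i j
  proof (cases "j \<in> P")
    case True
    then show ?thesis using p(1)[OF True] that by (auto simp: b_def meet_def)
  next
    case False
    then have "b j \<in> set cs" using that(2) ij(4) unfolding bjs[symmetric] by simp
    then show ?thesis using csP that(1) by (auto simp: meet_def)
  qed
  have "independent K (map b is @ cs)"
  proof (rule independent_append_separated[where U = V])
    show "\<And>i. i \<in> set is \<Longrightarrow> subspace (V i)" using V(1) P(1) ij(1) by auto
    show "\<And>i. i \<in> set is \<Longrightarrow> set cs \<subseteq> V i" using csP ij(1) by (auto simp: meet_def)
    show "\<And>i. i \<in> set is \<Longrightarrow> b i \<in> carrier R \<and> b i \<notin> V i" using bP Bc ij(1) by blast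
    show "\<And>i j. i \<in> set is \<Longrightarrow> j \<in> set is \<Longrightarrow> i \<noteq> j \<Longrightarrow> b j \<in> V i" using bV P(1) ij(1) by blast
  qed (use cs(2) ij(2) in auto)
  moreover define bs where "bs = map b [0..<n]"
  moreover have "set (map b is @ cs) = set bs"
    using ij(1,4) P(1) bjs[symmetric] by (auto simp: bs_def)
  moreover have "length (map b is @ cs) = length bs"
    using ij(3) cs(3) P(3) by (simp add: bs_def)
  ultimately have ind: "independent K bs" using independent_same_set[OF K] by blast
  have bsB: "set bs \<subseteq> B" using bB by (auto simp: bs_def)
  have len: "length bs = n" by (simp add: bs_def)
  have "ordered_basis K B bs"
    using independent_length_eq_dimension[OF K _ ind bsB, of n] assms(1) dimension_iff n_def len ind
      bsB Bc unfolding ordered_basis_def by blast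
  moreover have "U i \<subseteq> Span K (take i bs @ drop (Suc i) bs)" if "i \<in> P" for i
  proof -
    have i: "i < n" "bs ! i = b i" using that P(1) by (auto simp: bs_def)
    have Vi: "subspace (V i)" "V i \<subseteq> B" "U i \<subseteq> V i" using V(1) i(1) by auto
    have fVi: "fin_dim (V i)" by (rule fin_dim_mono[OF assms(1) Vi(1,2)])
    have "set (take i bs @ drop (Suc i) bs) \<subseteq> V i"
      using bV[OF that] i(1) len by (subst set_take_drop) (auto simp: bs_def)
    then have 1: "Span K (take i bs @ drop (Suc i) bs) \<subseteq> V i"
      by (rule subalgebra_Span_incl[OF K Vi(1)])
    have ind': "independent K (take i bs @ drop (Suc i) bs)"
      using independent_remove_nth(1)[OF ind] i(1) len by simp
    have 2: "Suc (dm (Span K (take i bs @ drop (Suc i) bs))) = n"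
      using independent_dm(2)[OF ind'] i(1) len by simp
    \<comment> \<open>The vector \<open>b i\<close> shows that \<open>V i\<close> is proper in
      \<open>B\<close>, so the span of the other \<open>n - 1\<close> basis vectors, being contained
      in \<open>V i\<close>, is all of it.\<close>
    have "dm (V i) \<noteq> n" using dm_eqD[OF assms(1) Vi(1,2)] bP[OF that] n_def by auto
    moreover have "dm (V i) \<le> n" using dm_mono[OF assms(1) Vi(1,2)] n_def by simp
    ultimately have "dm (V i) \<le> dm (Span K (take i bs @ drop (Suc i) bs))" using 2 by simp
    then show ?thesis
      using dm_eqD[OF fVi fin_dim_subspace[OF independent_dm(1)[OF ind']] 1] Vi(3) by simp
  qed
  \<comment> \<open>\<open>P\<close> may have more than \<open>n - e\<close> members, while
    \<open>partially_matched_bases\<close> prescribes the exact cardinality.\<close>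
  moreover obtain P' where "P' \<subseteq> P" "card P' = n - e"
    using obtain_subset_with_card_n[OF cardP] by metis
  ultimately show ?thesis using P(1) n_def by blast
qed

section \<open>Rado's criterion for partial matching\<close>

text \<open>With \<open>T = {a}\<close> for nonzero \<open>a\<close> this is
  \<open>inv a <# A\<close>, and with \<open>T = A\<close> the stabilizer of \<open>A\<close>. For
  general \<open>T\<close> it extends a condition on products from generators to their span.\<close>

lemma subspace_colon:
  assumes "subspace A" "T \<subseteq> carrier R"
  shows "subspace {s \<in> carrier R. \<forall>t\<in>T. s \<otimes> t \<in> A}"
proof (rule subspaceI)
  note A = subspaceD[OF assms(1)]
  show "\<zero> \<in> {s \<in> carrier R. \<forall>t\<in>T. s \<otimes> t \<in> A}" using A(2) assms(2) by auto
  show "x \<oplus> y \<in> {s \<in> carrier R. \<forall>t\<in>T. s \<otimes> t \<in> A}"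
    if "x \<in> {s \<in> carrier R. \<forall>t\<in>T. s \<otimes> t \<in> A}" "y \<in> {s \<in> carrier R. \<forall>t\<in>T. s \<otimes> t \<in> A}" for x y
    using that A(3) assms(2) by (auto simp: l_distr subset_iff)
  show "k \<otimes> x \<in> {s \<in> carrier R. \<forall>t\<in>T. s \<otimes> t \<in> A}"
    if "k \<in> K" "x \<in> {s \<in> carrier R. \<forall>t\<in>T. s \<otimes> t \<in> A}" for k x
    using that A(5) assms(2) K_in_carrier by (auto simp: m_assoc subset_iff)
qed auto

lemma mem_l_coset: "y \<in> a <# V \<longleftrightarrow> (\<exists>x\<in>V. y = a \<otimes> x)"
  by (auto simp: l_coset_def)

lemma mem_inv_coset:
  assumes "A \<subseteq> carrier R" "a \<in> carrier R" "a \<noteq> \<zero>" "x \<in> carrier R"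
  shows "x \<in> inv a <# A \<longleftrightarrow> a \<otimes> x \<in> A"
proof
  assume "x \<in> inv a <# A"
  then obtain y where y: "y \<in> A" "x = inv a \<otimes> y" by (auto simp: mem_l_coset)
  then have "a \<otimes> x = (a \<otimes> inv a) \<otimes> y" using assms field_Units m_assoc[of a "inv a" y] by auto
  then show "a \<otimes> x \<in> A" using y assms field_Units by auto
next
  assume *: "a \<otimes> x \<in> A"
  have "x = (inv a \<otimes> a) \<otimes> x" using assms field_Units by simp
  also have "\<dots> = inv a \<otimes> (a \<otimes> x)" using assms field_Units m_assoc[of "inv a" a x] by auto
  finally show "x \<in> inv a <# A" using * by (auto simp: mem_l_coset)
qed

lemma independent_nth_nonzero:
  assumes "independent K xs" "i < length xs"
  shows "xs ! i \<noteq> \<zero>"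
  using independent_remove_nth[OF assms] Span_subgroup_props(2)[OF K] independent_in_carrier by metis

lemma independent_nths:
  assumes "independent K xs" "J \<subseteq> {..<length xs}"
  shows "independent K (map ((!) xs) (sorted_list_of_set J))"
proof -
  let ?l = "\<lambda>I. map ((!) xs) (sorted_list_of_set I)"
  have fin: "finite J" using assms(2) finite_subset by auto
  have "independent K (?l J @ ?l ({..<length xs} - J))"
  proof (rule independent_same_set[OF K _ _ assms(1)])
    have "set (?l J @ ?l ({..<length xs} - J)) = (!) xs ` (J \<union> ({..<length xs} - J))"
      using fin by (auto simp del: Un_Diff_cancel)
    also have "J \<union> ({..<length xs} - J) = {0..<length xs}" using assms(2) by auto
    finally show "set xs = set (?l J @ ?l ({..<length xs} - J))" by (simp add: nth_image)
    show "length xs = length (?l J @ ?l ({..<length xs} - J))"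
      using fin assms(2) card_mono[OF _ assms(2)] by (simp add: card_Diff_subset)
  qed
  then show ?thesis using independent_split(2)[OF K] by blast
qed

text \<open>Given a set \<open>J\<close> of positions, let \<open>S\<close> be the span of the basis
  vectors of \<open>A\<close> there and \<open>T\<close> the meet of the spaces \<open>U i\<close>.
  Then all products of \<open>S\<close> and \<open>T\<close> lie in \<open>A\<close> and
  \<open>dm S = card J\<close>, so \<open>bound\<close> becomes Rado's condition.\<close>

lemma partially_matchedI:
  assumes "fin_dim A" "fin_dim B" "dm A = dm B" "e \<le> dm B"
    and bound: "\<And>S T. subspace S \<Longrightarrow> subspace T \<Longrightarrow> S \<subseteq> A \<Longrightarrow> T \<subseteq> B \<Longrightarrow>
      (\<And>s t. s \<in> S \<Longrightarrow> t \<in> T \<Longrightarrow> s \<otimes> t \<in> A) \<Longrightarrow> dm S + dm T \<le> dm B + e"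
  shows "partially_matched K A B e"
  unfolding partially_matched_def
proof (intro allI impI)
  fix as assume "ordered_basis K A as"
  then have as: "set as \<subseteq> carrier R" "independent K as" "Span K as = A"
    by (auto simp: ordered_basis_def)
  have len: "length as = dm B" using independent_dm(2)[OF as(2)] as(3) assms(3) by simp
  have sA: "subspace A" and sB: "subspace B" using assms(1,2) fin_dim_subspace by auto
  note Ac = subspaceD(1)[OF sA] and Bc = subspaceD(1)[OF sB]
  define U where "U i = (inv (as ! i) <# A) \<inter> B" for i
  have nth: "as ! i \<in> carrier R" "as ! i \<noteq> \<zero>" if "i < dm B" for i
    using that len as(1) independent_nth_nonzero[OF as(2)] nth_mem by (metis subsetD)+
  have U: "x \<in> U i \<longleftrightarrow> x \<in> B \<and> as ! i \<otimes> x \<in> A" if "i < dm B" for i x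
    using mem_inv_coset[OF Ac nth[OF that]] Bc unfolding U_def by blast
  have sU: "subspace (U i)" if "i < dm B" for i
  proof -
    have "U i = {x \<in> carrier R. \<forall>t\<in>{as ! i}. x \<otimes> t \<in> A} \<inter> B"
      using U[OF that] Bc nth[OF that] by (auto simp: m_comm subset_iff)
    then show ?thesis
      using subalgebra_inter[OF subspace_colon[OF sA, of "{as ! i}"] sB] nth(1)[OF that] by simp
  qed
  have "rado_condition B U {..<dm B} e"
    unfolding rado_condition_def
  proof (intro allI impI)
    fix J assume J: "J \<subseteq> {..<dm B}"
    then have fin: "finite J" using finite_subset by auto
    define us where "us = map ((!) as) (sorted_list_of_set J)"
    have us: "independent K us" "set us = (!) as ` J" "length us = card J"
      using independent_nths[OF as(2)] J len fin by (auto simp: us_def)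
    let ?T = "meet B U J"
    have sT: "subspace ?T" using J sU by (intro subspace_meet[OF sB]) auto
    have Tc: "?T \<subseteq> carrier R" by (rule subspaceD(1)[OF sT])
    have "set us \<subseteq> {s \<in> carrier R. \<forall>t\<in>?T. s \<otimes> t \<in> A}"
      using us(2) nth(1) J U by (auto simp: meet_def subset_iff)
    from subalgebra_Span_incl[OF K subspace_colon[OF sA Tc] this]
    have *: "s \<otimes> t \<in> A" if "s \<in> Span K us" "t \<in> ?T" for s t using that by blast
    have "set us \<subseteq> set as" using us(2) J len by (auto)
    then have "Span K us \<subseteq> A" using mono_Span_sublist[OF K _ as(1)] as(3) by blast
    moreover have "subspace (Span K us)" by (rule fin_dim_subspace[OF independent_dm(1)[OF us(1)]])
    ultimately have "dm (Span K us) + dm ?T \<le> dm B + e"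
      using * sT by (intro bound) (auto simp: meet_def)
    then show "dm (meet B U J) + card J \<le> dm B + e"
      using independent_dm(2)[OF us(1)] us(3) by simp
  qed
  from rado_basis[OF assms(2) _ this] sU obtain bs P where
    "ordered_basis K B bs" "P \<subseteq> {..<dm B}" "card P = dm B - e"
    "\<forall>i\<in>P. U i \<subseteq> Span K (take i bs @ drop (Suc i) bs)"
    by (auto simp: U_def)
  then show "\<exists>bs. ordered_basis K B bs \<and> partially_matched_bases K A B as bs e"
    using len assms(4) unfolding partially_matched_bases_def U_def by metis
qed

text \<open>A basis of \<open>A\<close> that ends in a basis of \<open>S\<close> has at least
  \<open>dm S - e\<close> matched positions in that final part. At each of them \<open>T\<close>
  lies in the hyperplane spanned by the other members of the basis of \<open>B\<close>, so the
  members at these positions are independent together with a basis of \<open>T\<close>.\<close>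

lemma partially_matchedD:
  assumes "partially_matched K A B e" "fin_dim A" "fin_dim B" "dm A = dm B"
    and "subspace S" "subspace T" "S \<subseteq> A" "T \<subseteq> B"
    and ST: "\<And>s t. s \<in> S \<Longrightarrow> t \<in> T \<Longrightarrow> s \<otimes> t \<in> A"
  shows "dm S + dm T \<le> dm B + e"
proof -
  define n where "n = dm B"
  have sA: "subspace A" and sB: "subspace B" using assms(2,3) fin_dim_subspace by auto
  note Ac = subspaceD(1)[OF sA] and Bc = subspaceD(1)[OF sB]
  obtain us where us: "set us \<subseteq> carrier R" "independent K us" "length us = dm S" "Span K us = S"
    using obtain_basis[OF fin_dim_mono[OF assms(2,5,7)]] .
  obtain cs where cs: "set cs \<subseteq> carrier R" "independent K cs" "length cs = dm T" "Span K cs = T"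
    using obtain_basis[OF fin_dim_mono[OF assms(3,6,8)]] .
  have usS: "set us \<subseteq> S" and csT: "set cs \<subseteq> T"
    using Span_base_incl[OF K us(1)] us(4) Span_base_incl[OF K cs(1)] cs(4) by auto
  then obtain vs where vs: "length (vs @ us) = n" "independent K (vs @ us)" "Span K (vs @ us) = A"
    using complete_base[OF K _ us(2), of n A] assms(2,4,7) dimension_iff n_def by blast
  have "ordered_basis K A (vs @ us)"
    using vs independent_in_carrier[OF vs(2)] by (simp add: ordered_basis_def)
  then obtain bs P where bs: "ordered_basis K B bs" and e: "e \<le> n" and
    P: "P \<subseteq> {..<n}" "card P = n - e"
      "\<forall>i\<in>P. (inv ((vs @ us) ! i) <# A) \<inter> B \<subseteq> Span K (take i bs @ drop (Suc i) bs)"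
    using assms(1) vs(1) unfolding partially_matched_def partially_matched_bases_def by metis
  have ind: "independent K bs" and bsc: "set bs \<subseteq> carrier R" and spB: "Span K bs = B"
    using bs by (auto simp: ordered_basis_def)
  have len: "length bs = n" using independent_dm(2)[OF ind] spB n_def by simp
  \<comment> \<open>\<open>complete_base\<close> prepends \<open>vs\<close>, so \<open>us\<close>
    occupies the positions from \<open>length vs\<close> on.\<close>
  define J where "J = P \<inter> {length vs..<n}"
  have fin: "finite J" by (simp add: J_def)
  have "card P + card {length vs..<n} = card (P \<union> {length vs..<n}) + card J"
    using P(1) finite_subset unfolding J_def by (intro card_Un_Int) auto
  moreover have "card (P \<union> {length vs..<n}) \<le> n"
    using card_mono[of "{..<n}" "P \<union> {length vs..<n}"] P(1) by force
  ultimately have cardJ: "dm S \<le> card J + e" using P(2) e vs(1) us(3) by simp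
  let ?H = "\<lambda>i. Span K (take i bs @ drop (Suc i) bs)"
  have oc: "set (take i bs @ drop (Suc i) bs) \<subseteq> carrier R" for i
    using bsc set_take_subset[of i bs] set_drop_subset[of "Suc i" bs] by auto
  have "independent K (map ((!) bs) (sorted_list_of_set J) @ cs)"
  proof (rule independent_append_separated[where U = ?H])
    fix i assume "i \<in> set (sorted_list_of_set J)"
    then have i: "i \<in> P" "i < n" "length vs \<le> i" using fin by (auto simp: J_def)
    let ?a = "(vs @ us) ! i"
    have a: "?a \<in> carrier R" "?a \<noteq> \<zero>" "?a \<in> S"
      using i vs(1) independent_nth_nonzero[OF vs(2), of i] independent_in_carrier[OF vs(2)] usS
        nth_mem[of "i - length vs" us] by (auto simp: nth_append)
    show "subspace (?H i)" by (rule Span_is_subalgebra[OF K oc])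
    \<comment> \<open>As \<open>?a \<in> S\<close>, the assumption on products puts all of
      \<open>T\<close> into the space controlled by the matching at \<open>i\<close>.\<close>
    have "x \<in> (inv ?a <# A) \<inter> B" if "x \<in> T" for x
      using mem_inv_coset[OF Ac a(1,2)] ST[OF a(3) that] that assms(8) Bc by blast
    then show "set cs \<subseteq> ?H i" using csT P(3) i(1) by blast
    show "bs ! i \<in> carrier R \<and> bs ! i \<notin> ?H i"
      using independent_remove_nth(2)[OF ind] i(2) len bsc nth_mem by blast
    fix j assume "j \<in> set (sorted_list_of_set J)" "i \<noteq> j"
    then have "bs ! j \<in> set (take i bs @ drop (Suc i) bs)"
      using i(2) len fin by (subst set_take_drop) (auto simp: J_def)
    then show "bs ! j \<in> ?H i" using Span_base_incl[OF K oc] by blast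
  qed (use cs(2) in auto)
  moreover have "set (map ((!) bs) (sorted_list_of_set J) @ cs) \<subseteq> B"
    using fin len csT assms(8) Span_base_incl[OF K bsc] spB by (auto simp: J_def)
  ultimately have "length (map ((!) bs) (sorted_list_of_set J) @ cs) \<le> n"
    using independent_length_le_dimension[OF K] assms(3) dimension_iff n_def by blast
  then show ?thesis using cardJ cs(3) n_def by simp
qed

section \<open>Scaling, stabilizers and the linear Olson theorem\<close>

lemma scale_line_extension:
  assumes "V \<subseteq> carrier R" "v \<in> carrier R" "a \<in> carrier R"
  shows "a <# line_extension K v V = line_extension K (a \<otimes> v) (a <# V)"
proof -
  have *: "a \<otimes> (k \<otimes> v \<oplus> w) = k \<otimes> (a \<otimes> v) \<oplus> a \<otimes> w" if "k \<in> K" "w \<in> V" for k w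
    using that assms K_in_carrier by (auto simp: subset_iff r_distr m_lcomm)
  show ?thesis
  proof (intro equalityI subsetI)
    fix y assume "y \<in> a <# line_extension K v V"
    then obtain k w where "k \<in> K" "w \<in> V" "y = a \<otimes> (k \<otimes> v \<oplus> w)"
      unfolding Bex_def mem_l_coset line_extension_mem_iff by blast
    then show "y \<in> line_extension K (a \<otimes> v) (a <# V)"
      using * unfolding Bex_def mem_l_coset line_extension_mem_iff by blast
  next
    fix y assume "y \<in> line_extension K (a \<otimes> v) (a <# V)"
    then obtain k w where "k \<in> K" "w \<in> V" "y = k \<otimes> (a \<otimes> v) \<oplus> a \<otimes> w"
      unfolding Bex_def mem_l_coset line_extension_mem_iff by blast
    then show "y \<in> a <# line_extension K v V"
      using *[of k w] unfolding Bex_def mem_l_coset line_extension_mem_iff by metis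
  qed
qed

lemma dimension_scale:
  assumes "dimension n K V" "a \<in> carrier R" "a \<noteq> \<zero>"
  shows "dimension n K (a <# V)"
  using assms(1)
proof (induction n arbitrary: V)
  case 0
  then have "V = {\<zero>}" by (rule dimension_zero[OF K])
  moreover have "a <# {\<zero>} = {\<zero>}" using assms(2) by (auto simp: mem_l_coset)
  ultimately show ?case by auto
next
  case (Suc n)
  obtain v E where v: "v \<in> carrier R" "v \<notin> E" "dimension n K E" "V = line_extension K v E"
    using dimension_backwards[OF K Suc.prems] by blast
  have E: "E \<subseteq> carrier R" by (rule space_subgroup_props(1)[OF K v(3)])
  have "a \<otimes> v \<notin> a <# E"
  proof
    assume "a \<otimes> v \<in> a <# E"
    then obtain x where "x \<in> E" "a \<otimes> v = a \<otimes> x" by (auto simp: mem_l_coset)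
    then have "v = x" using m_lcancel[OF assms(3,2)] v(1) E by blast
    then show False using \<open>x \<in> E\<close> v(2) by simp
  qed
  then show ?case
    using Suc_dim[of "a \<otimes> v" "a <# E" n K] Suc.IH[OF v(3)] v(1) assms(2)
    by (simp add: v(4) scale_line_extension[OF E])
qed

lemma fin_dim_scale:
  assumes "fin_dim V" "a \<in> carrier R" "a \<noteq> \<zero>"
  shows "fin_dim (a <# V)" "dm (a <# V) = dm V"
  using dimension_scale[OF _ assms(2,3), of "dm V" V] assms(1) dimension_iff by auto

lemma subspace_scale:
  assumes "subspace V" "a \<in> carrier R"
  shows "subspace (a <# V)"
proof (rule subspaceI)
  note V = subspaceD[OF assms(1)]
  note c = subsetD[OF V(1)] subsetD[OF K_in_carrier] assms(2)
  show "a <# V \<subseteq> carrier R" using c by (auto simp: mem_l_coset)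
  show "\<zero> \<in> a <# V" using V(2) c by (auto simp: mem_l_coset intro!: bexI[of _ \<zero>])
  fix x y assume "x \<in> a <# V" "y \<in> a <# V"
  then obtain v w where *: "v \<in> V" "w \<in> V" "x = a \<otimes> v" "y = a \<otimes> w" by (auto simp: mem_l_coset)
  then have "x \<oplus> y = a \<otimes> (v \<oplus> w)" using c by (simp add: r_distr)
  then show "x \<oplus> y \<in> a <# V" using V(3) * by (auto simp: mem_l_coset)
next
  note V = subspaceD[OF assms(1)]
  note c = subsetD[OF V(1)] subsetD[OF K_in_carrier] assms(2)
  fix k x assume k: "k \<in> K" and "x \<in> a <# V"
  then obtain v where *: "v \<in> V" "x = a \<otimes> v" by (auto simp: mem_l_coset)
  then have "k \<otimes> x = a \<otimes> (k \<otimes> v)" using c k by (simp add: m_lcomm)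
  then show "k \<otimes> x \<in> a <# V" using V(5)[OF k] * by (auto simp: mem_l_coset)
qed

text \<open>For nonzero \<open>x\<close> in \<open>H\<close>, the inclusion of \<open>x <# A\<close>
  in \<open>A\<close> is an equality by dimension, so \<open>inv x\<close> stabilizes
  \<open>A\<close> as well. Scaling by a nonzero \<open>a \<in> A\<close> embeds \<open>H\<close>
  into \<open>A\<close>, which makes \<open>H\<close> finite-dimensional.\<close>

lemma stabilizer_subfield:
  assumes "fin_dim A" "A \<noteq> {\<zero>}"
  defines "H \<equiv> {x \<in> carrier R. \<forall>a\<in>A. x \<otimes> a \<in> A}"
  shows "subfield H R" "K \<subseteq> H" "fin_dim H"
proof -
  have sA: "subspace A" by (rule fin_dim_subspace[OF assms(1)])
  note A = subspaceD[OF sA]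
  have sH: "subspace H" unfolding H_def by (rule subspace_colon[OF sA A(1)])
  note H = subspaceD[OF sH]
  have "subring H R"
  proof (rule subringI)
    show "H \<subseteq> carrier R" by (rule H(1))
    show "\<one> \<in> H" using A(1) by (auto simp: H_def subset_iff)
    show "h1 \<otimes> h2 \<in> H" if "h1 \<in> H" "h2 \<in> H" for h1 h2
      using that A(1) by (auto simp: H_def m_assoc subset_iff)
  qed (rule H(4), assumption, rule H(3))
  moreover have "inv x \<in> H" if "x \<in> H - {\<zero>}" for x
  proof -
    have x: "x \<in> carrier R" "x \<noteq> \<zero>" "x \<in> Units R" using that H(1) field_Units by auto
    have "x <# A \<subseteq> A" using that by (auto simp: H_def mem_l_coset)
    then have *: "x <# A = A"
      using dm_eqD[OF assms(1) subspace_scale[OF sA x(1)]] fin_dim_scale(2)[OF assms(1) x(1,2)] by simp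
    have "inv x \<otimes> a \<in> A" if "a \<in> A" for a
    proof -
      have "a \<in> x <# A" using * that by metis
      then obtain a' where a': "a' \<in> A" "a = x \<otimes> a'" unfolding mem_l_coset by blast
      then have "inv x \<otimes> a = (inv x \<otimes> x) \<otimes> a'"
        using x A(1) m_assoc[of "inv x" x a'] by auto
      then show ?thesis using a' x A(1) by auto
    qed
    then show ?thesis using x(3) by (simp add: H_def)
  qed
  ultimately show "subfield H R" by (rule subfieldI')
  show "K \<subseteq> H" using A(5) K_in_carrier by (auto simp: H_def)
  obtain a where a: "a \<in> A" "a \<noteq> \<zero>" using assms(2) A(2) by auto
  then have ac: "a \<in> carrier R" "a \<in> Units R" using A(1) field_Units by auto
  have "a <# H \<subseteq> A" using a ac by (auto simp: mem_l_coset H_def m_comm)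
  then have "fin_dim (a <# H)" by (rule fin_dim_mono[OF assms(1) subspace_scale[OF sH ac(1)]])
  moreover have "inv a \<noteq> \<zero>" using a(2) ac by (metis Units_r_inv r_null zero_not_one)
  moreover have "inv a <# (a <# H) = H"
  proof -
    have *: "inv a \<otimes> (a \<otimes> x) = x" if "x \<in> H" for x
      using that H(1) ac m_assoc[of "inv a" a x] by auto
    have "y \<in> inv a <# (a <# H) \<longleftrightarrow> (\<exists>x\<in>H. y = inv a \<otimes> (a \<otimes> x))" for y
      unfolding Bex_def mem_l_coset by blast
    then have "y \<in> inv a <# (a <# H) \<longleftrightarrow> y \<in> H" for y using * by metis
    then show ?thesis by blast
  qed
  ultimately show "fin_dim H" using fin_dim_scale(1)[of "a <# H" "inv a"] ac by auto
qed

text \<open>A linear version of Olson's theorem, by the Dyson transform: as long as some \<open>a \<in> A\<close> has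
  \<open>a B \<notsubseteq> A\<close>, pass to \<open>A + a B\<close> and \<open>B \<inter> a\<^sup>-\<^sup>1 A\<close>.\<close>

lemma linear_olson:
  assumes "fin_dim A" "fin_dim B" "A \<noteq> {\<zero>}" "\<one> \<in> B" "subspace C"
    and "\<And>a b. a \<in> A \<Longrightarrow> b \<in> B \<Longrightarrow> a \<otimes> b \<in> C"
  shows "\<exists>H W. subfield H R \<and> K \<subseteq> H \<and> fin_dim H \<and> fin_dim W \<and> W \<subseteq> C \<and> W \<noteq> {\<zero>} \<and>
    (\<forall>h\<in>H. \<forall>w\<in>W. h \<otimes> w \<in> W) \<and> dm A + dm B \<le> dm W + dm H"
  using assms(1-4,6)
proof (induction "dm B" arbitrary: A B rule: less_induct)
  case less
  have sA: "subspace A" and sB: "subspace B" using less.prems(1,2) fin_dim_subspace by auto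
  note A = subspaceD[OF sA] and B = subspaceD[OF sB] and C = subspaceD[OF assms(5)]
  note c = subsetD[OF A(1)] subsetD[OF B(1)]
  show ?case
  proof (cases "\<forall>a\<in>A. \<forall>b\<in>B. a \<otimes> b \<in> A")
    case True
    \<comment> \<open>Here \<open>B\<close> consists of stabilizing elements, so the stabilizer and
      \<open>W = A\<close> are the witnesses; \<open>\<one> \<in> B\<close> gives
      \<open>A \<subseteq> C\<close>.\<close>
    let ?H = "{x \<in> carrier R. \<forall>a\<in>A. x \<otimes> a \<in> A}"
    note H = stabilizer_subfield[OF less.prems(1,3)]
    have "B \<subseteq> ?H"
    proof
      fix x assume "x \<in> B"
      then show "x \<in> ?H" using True c m_comm[of x] by auto
    qed
    then have "dm B \<le> dm ?H" by (rule dm_mono[OF H(3) sB])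
    moreover have "A \<subseteq> C"
    proof
      fix a assume "a \<in> A"
      then show "a \<in> C" using less.prems(5)[OF _ less.prems(4), of a] c by simp
    qed
    ultimately show ?thesis
      using H less.prems(1,3) by (intro exI[of _ ?H] exI[of _ A]) auto
  next
    case False
    then obtain a b where ab: "a \<in> A" "b \<in> B" "a \<otimes> b \<notin> A" by blast
    have a: "a \<in> carrier R" "a \<noteq> \<zero>" using ab A(2) c by auto
    let ?aB = "a <# B"
    define A' where "A' = A <+>\<^bsub>R\<^esub> ?aB"
    define B' where "B' = {x \<in> carrier R. \<forall>t\<in>{a}. x \<otimes> t \<in> A} \<inter> B"
    have B': "x \<in> B' \<longleftrightarrow> x \<in> B \<and> a \<otimes> x \<in> A" for x
      using c a by (auto simp: B'_def m_comm)
    have saB: "subspace ?aB" by (rule subspace_scale[OF sB a(1)])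
    note faB = fin_dim_scale[OF less.prems(2) a]
    have sB': "subspace B'"
      unfolding B'_def using a(1) by (intro subalgebra_inter subspace_colon sA sB) auto
    have B'B: "B' \<subseteq> B" using B' by blast
    have fB': "fin_dim B'" by (rule fin_dim_mono[OF less.prems(2) sB' B'B])
    \<comment> \<open>The transform moves dimension from \<open>B\<close> to \<open>A\<close>
      without loss: what \<open>A\<close> and \<open>?aB\<close> share is exactly \<open>B'\<close>
      scaled by \<open>a\<close>.\<close>
    have "y \<in> A \<inter> ?aB \<longleftrightarrow> y \<in> a <# B'" for y unfolding mem_l_coset Int_iff using B' by metis
    then have "A \<inter> ?aB = a <# B'" by blast
    then have dims: "dm A' + dm B' = dm A + dm B"
      using dm_sum_inter(2)[OF less.prems(1) faB(1)] faB(2) fin_dim_scale(2)[OF fB' a]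
      by (simp add: A'_def)
    have lt: "dm B' < dm B"
      using dm_mono[OF less.prems(2) sB' B'B] dm_eqD[OF less.prems(2) sB' B'B] ab B'
      by (metis linorder_not_le order_le_less)
    have fA': "fin_dim A'" unfolding A'_def by (rule dm_sum_inter(1)[OF less.prems(1) faB(1)])
    have "A' \<noteq> {\<zero>}" using sum_subspace(2)[OF sA saB] ab(1) a(2) unfolding A'_def by blast
    moreover have "\<one> \<in> B'" using B' less.prems(4) ab(1) a by simp
    moreover have "x \<otimes> y \<in> C" if xy: "x \<in> A'" "y \<in> B'" for x y
    proof -
      obtain a1 z where "a1 \<in> A" "z \<in> ?aB" "x = a1 \<oplus> z"
        using xy(1) unfolding A'_def set_add_def' by blast
      then obtain b1 where x: "a1 \<in> A" "b1 \<in> B" "x = a1 \<oplus> a \<otimes> b1"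
        unfolding mem_l_coset by blast
      have y: "y \<in> B" "a \<otimes> y \<in> A" using xy(2) B' by auto
      have carr: "a1 \<in> carrier R" "b1 \<in> carrier R" "y \<in> carrier R" using x y(1) c by auto
      have "x \<otimes> y = a1 \<otimes> y \<oplus> (a \<otimes> b1) \<otimes> y" using x(3) carr a(1) by (simp add: l_distr)
      \<comment> \<open>Commutativity moves \<open>y\<close> next to \<open>a\<close>: then
        \<open>a \<otimes> y\<close> is in \<open>A\<close> by the choice of \<open>B'\<close>, and
        its product with \<open>b1\<close> is in \<open>C\<close>.\<close>
      also have "(a \<otimes> b1) \<otimes> y = (a \<otimes> y) \<otimes> b1" using carr a(1) by (simp add: m_ac)
      finally have "x \<otimes> y = a1 \<otimes> y \<oplus> (a \<otimes> y) \<otimes> b1" .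
      then show ?thesis using less.prems(5) x y C(3) by simp
    qed
    ultimately show ?thesis
      using less.hyps[OF lt fA' fB'] dims by simp
  qed
qed

section \<open>Upper bound for the deficiency\<close>

text \<open>The tower law applies once \<open>W\<close> is finite-dimensional over \<open>H\<close>,
  and it is, because a \<open>K\<close>-basis of \<open>W\<close> spans it over
  \<open>H\<close>.\<close>

lemma dm_subfield_dvd:
  assumes "subfield H R" "K \<subseteq> H" "fin_dim H" "fin_dim W" "\<And>h w. h \<in> H \<Longrightarrow> w \<in> W \<Longrightarrow> h \<otimes> w \<in> W"
  shows "dm H dvd dm W"
proof -
  obtain us where us: "set us \<subseteq> carrier R" "Span K us = W" using obtain_basis[OF assms(4)] .
  \<comment> \<open>A second instance of the locale, with \<open>H\<close> as the field of
    scalars.\<close>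
  interpret H: field_extension R H
    by (intro field_extension.intro field_axioms field_extension_axioms.intro assms(1))
  note W = subspaceD[OF fin_dim_subspace[OF assms(4)]]
  have "set us \<subseteq> W" using Span_base_incl[OF K us(1)] us(2) by simp
  then have "Span H us \<subseteq> W"
    using assms(5) W by (intro subalgebra_Span_incl[OF assms(1)] H.subspaceI) auto
  moreover have "subspace (Span H us)"
    using Span_subgroup_props[OF assms(1) us(1)] Span_smult_closed[OF assms(1) us(1)] assms(2)
    by (intro subspaceI) auto
  then have "W \<subseteq> Span H us"
    using subalgebra_Span_incl[OF K] Span_base_incl[OF assms(1) us(1)] us(2) by blast
  ultimately have "W = Span H us" by simp
  then have "H.fin_dim W" using Span_finite_dimension[OF assms(1) us(1)] by simp
  from telescopic_base_dim(2)[OF K assms(1,3) this] show ?thesis by simp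
qed

text \<open>Supplies the hypothesis \<open>bound\<close> of \<open>partially_matchedI\<close> for
  the defect \<open>D\<close>. The assumption \<open>large\<close> keeps the field obtained from
  \<open>linear_olson\<close> proper.\<close>

lemma deficiency_bound:
  assumes "fin_dim A" "fin_dim B" "dm A = n" "dm B = n" "\<one> \<notin> B"
    and large: "fin_dim (carrier R) \<Longrightarrow> n < dm (carrier R)"
    and D: "\<And>m. m \<in> intermediate_degrees K \<Longrightarrow> m \<le> n \<Longrightarrow> m - 1 - n mod m \<le> D"
    and "subspace S" "subspace T" "S \<subseteq> A" "T \<subseteq> B"
    and ST: "\<And>s t. s \<in> S \<Longrightarrow> t \<in> T \<Longrightarrow> s \<otimes> t \<in> A"
  shows "dm S + dm T \<le> n + D"
proof (cases "S = {\<zero>}")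
  \<comment> \<open>\<open>linear_olson\<close> requires a nonzero space; for zero \<open>S\<close>
    the bound is just \<open>dm T \<le> n\<close>.\<close>
  case True
  then show ?thesis using dm_mono[OF assms(2,9,11)] zero_space(2) assms(4) by simp
next
  case False
  have fS: "fin_dim S" and fT: "fin_dim T" using fin_dim_mono assms by blast+
  note S = subspaceD[OF assms(8)] and T = subspaceD[OF assms(9)]
  have sA: "subspace A" by (rule fin_dim_subspace[OF assms(1)])
  note A = subspaceD[OF sA]
  have "\<one> \<notin> T" using assms(5,11) by blast
  let ?T = "line_extension K \<one> T"
  note T' = line_extension_fin_dim[OF fT one_closed \<open>\<one> \<notin> T\<close>]
    line_extension_incl[OF assms(9) one_closed]
  \<comment> \<open>Adjoining \<open>\<one>\<close> to \<open>T\<close> keeps the products in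
    \<open>A\<close> because \<open>S \<subseteq> A\<close>, and gains one dimension because
    \<open>\<one> \<notin> T\<close>.\<close>
  have "s \<otimes> t \<in> A" if s: "s \<in> S" and t: "t \<in> ?T" for s t
  proof -
    obtain k t' where k: "k \<in> K" "t' \<in> T" "t = k \<otimes> \<one> \<oplus> t'"
      using t unfolding line_extension_mem_iff by blast
    have "s \<otimes> t = k \<otimes> s \<oplus> s \<otimes> t'"
      using s k S(1) T(1) K_in_carrier by (auto simp: subset_iff r_distr m_comm)
    then show ?thesis using A(3) A(5)[OF k(1)] ST[OF s k(2)] s assms(10) by auto
  qed
  from linear_olson[OF fS T'(1) False T'(4) sA this] obtain H W where
    H: "subfield H R" "K \<subseteq> H" "fin_dim H" and W: "fin_dim W" "W \<subseteq> A" "W \<noteq> {\<zero>}"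
      "\<And>h w. h \<in> H \<Longrightarrow> w \<in> W \<Longrightarrow> h \<otimes> w \<in> W" and dims: "dm S + dm ?T \<le> dm W + dm H" by blast
  have Wn: "dm W \<le> n" using dm_mono[OF assms(1) fin_dim_subspace[OF W(1)] W(2)] assms(3) by simp
  show ?thesis
  proof (cases "H = K")
    case True
    \<comment> \<open>The dimension gained by \<open>?T\<close> cancels \<open>dm H = 1\<close>,
      leaving \<open>dm S + dm T \<le> dm W\<close>.\<close>
    have "dm K = 1" using dimI[OF K dimension_one[OF K]] .
    then show ?thesis using dims T'(2) Wn True by simp
  next
    case False
    have dvd: "dm H dvd dm W" by (rule dm_subfield_dvd[OF H W(1,4)])
    moreover have "dm W > 0" using dm_eq_0D[OF W(1)] W(3) by blast
    ultimately have Hn: "dm H \<le> n" using dvd_imp_le Wn le_trans by blast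
    have "H \<noteq> carrier R" using large H(3) Hn by auto
    moreover have "H \<subseteq> carrier R" using subspaceD(1)[OF fin_dim_subspace[OF H(3)]] .
    ultimately have "dm H \<in> intermediate_degrees K"
      using H False dimension_iff unfolding intermediate_degrees_def by blast
    then have le: "dm H - 1 - n mod dm H \<le> D" using D Hn by simp
    have Hpos: "dm H > 0" using dvd \<open>dm W > 0\<close> by (metis dvd_0_left_iff gr0I)
    obtain q where q: "dm W = dm H * q" using dvd by (auto simp: dvd_def)
    have "q \<le> n div dm H" using Wn q Hpos by (simp add: less_eq_div_iff_mult_less_eq mult.commute)
    then have "dm W \<le> dm H * (n div dm H)" using q by simp
    moreover have "dm H * (n div dm H) + n mod dm H = n" by simp
    \<comment> \<open>This makes the truncated subtraction in \<open>le\<close> exact.\<close>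
    moreover have "n mod dm H < dm H" using Hpos by simp
    ultimately show ?thesis using le dims T'(2) by linarith
  qed
qed

section \<open>Extremal pairs for the lower bound\<close>

text \<open>An \<open>F\<close>-space \<open>V\<close> in the role of \<open>S\<close> absorbs
  products with \<open>T \<subseteq> F\<close>. Hence \<open>A\<close> need only contain
  \<open>V\<close> and \<open>B\<close> need only contain \<open>T\<close> and avoid
  \<open>\<one>\<close>, and both can be padded to dimension \<open>n\<close>.\<close>

lemma exists_extremal_pair:
  assumes F: "subfield F R" "K \<subset> F" "F \<subset> carrier R" "dimension m K F"
    and "m \<le> n" and large: "fin_dim (carrier R) \<Longrightarrow> n < dm (carrier R)"
  shows "\<exists>A B S T. fin_dim A \<and> fin_dim B \<and> dm A = n \<and> dm B = n \<and> \<one> \<notin> B \<and>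
    subspace S \<and> subspace T \<and> S \<subseteq> A \<and> T \<subseteq> B \<and> (\<forall>s\<in>S. \<forall>t\<in>T. s \<otimes> t \<in> A) \<and>
    dm S + dm T = n + (m - 1 - n mod m)"
proof -
  interpret F: field_extension R F 
    by (intro field_extension.intro field_axioms field_extension_axioms.intro F(1))
  have fF: "fin_dim F" and dF: "dm F = m" using F(4) dimension_iff by auto
  have sC: "subspace (carrier R)" by (rule carrier_is_subalgebra[OF K_in_carrier])
  have sFC: "F.subspace (carrier R)" by (rule carrier_is_subalgebra[OF F.K_in_carrier])
  have oneF: "\<one> \<in> F" using subring_props[OF F(1)] by blast
  have "\<one> \<notin> {\<zero>}" by simp
  from exists_hyperplane_avoiding[OF fF fin_dim_subspace[OF zero_space(1)] _ oneF this]
  obtain T where T: "fin_dim T" "T \<subseteq> F" "\<one> \<notin> T" "Suc (dm T) = m"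
    using subspaceD(2)[OF fin_dim_subspace[OF fF]] dF by auto
  have mpos: "m > 0" using T(4) by simp
  \<comment> \<open>There is room for \<open>V\<close>: if the degree over \<open>F\<close> is
    finite, the tower law turns \<open>large\<close> into
    \<open>n div m < F.dm (carrier R)\<close>.\<close>
  have "\<exists>V. F.fin_dim V \<and> {\<zero>} \<subseteq> V \<and> V \<subseteq> carrier R \<and> F.dm V = n div m"
  proof (rule F.exists_between[OF sFC F.zero_space(1)])
    assume "F.fin_dim (carrier R)"
    from telescopic_base_dim[OF K F(1) fF this] large dF have "n < m * F.dm (carrier R)" by simp
    then have "n div m < F.dm (carrier R)" using mpos by (simp add: div_less_iff_less_mult mult.commute)
    then show "n div m \<le> F.dm (carrier R)" by simp
  qed (simp_all add: F.zero_space(2))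
  then obtain V where V: "F.fin_dim V" "V \<subseteq> carrier R" "F.dm V = n div m" by blast
  have fV: "fin_dim V" and dV: "dm V = m * (n div m)"
    using telescopic_base_dim[OF K F(1) fF V(1)] dF V(3) by auto
  have "\<exists>A. fin_dim A \<and> V \<subseteq> A \<and> A \<subseteq> carrier R \<and> dm A = n"
    using exists_between[OF sC fV V(2), of n] dV large by (simp add: less_imp_le)
  then obtain A where A: "fin_dim A" "V \<subseteq> A" "dm A = n" by blast
  \<comment> \<open>\<open>B\<close> is a hyperplane through \<open>T\<close>, avoiding
    \<open>\<one>\<close>, of a space of dimension \<open>Suc n\<close> that contains
    \<open>F\<close> and so \<open>\<one>\<close>.\<close>
  have "\<exists>W. fin_dim W \<and> F \<subseteq> W \<and> W \<subseteq> carrier R \<and> dm W = Suc n"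
    using exists_between[OF sC fF, of "Suc n"] F(3) dF assms(5) large by (simp add: Suc_leI psubset_imp_subset)
  then obtain W where W: "fin_dim W" "F \<subseteq> W" "dm W = Suc n" by blast
  from exists_hyperplane_avoiding[OF W(1) fin_dim_subspace[OF T(1)] _ _ T(3)] W T(2) oneF
  obtain B where B: "fin_dim B" "T \<subseteq> B" "\<one> \<notin> B" "dm B = n" by auto
  have "s \<otimes> t \<in> A" if "s \<in> V" "t \<in> T" for s t
  proof -
    have "t \<otimes> s \<in> V" using F.subspaceD(5)[OF F.fin_dim_subspace[OF V(1)]] that T(2) by blast
    moreover have "t \<otimes> s = s \<otimes> t" using that V(2) T(2) F(3) by (intro m_comm) auto
    ultimately show ?thesis using A(2) by auto
  qed
  moreover have "dm V + dm T = n + (m - 1 - n mod m)"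
  proof -
    have "m * (n div m) + n mod m = n" "n mod m < m" using mpos by auto
    then show ?thesis using dV T(4) by linarith
  qed
  ultimately show ?thesis
    using A B fin_dim_subspace[OF T(1)] fin_dim_subspace[OF fV]
    by (intro exI[of _ A] exI[of _ B] exI[of _ V] exI[of _ T] conjI ballI) assumption+
qed

end

section \<open>The two bounds combined\<close>

theorem theorem4p5:
  fixes L :: "('a, 'b) ring_scheme" and K :: "'a set" and n :: nat
  assumes "field L" and "subfield K L" and "K \<subset> carrier L"
    and "\<exists>F. subfield F L \<and> K \<subset> F \<and> F \<subset> carrier L \<and> ring.finite_dimension L K F"
    and "field.min_degree L K \<le> n"
    and "enat n < field.ext_degree L K (carrier L)"
  shows "field.max_deficiency L K n =
    Max {m - 1 - n mod m | m. m \<in> field.intermediate_degrees L K \<and> m \<le> n}"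
proof -
  interpret field L by fact
  interpret field_extension L K
    by (intro field_extension.intro field_axioms field_extension_axioms.intro assms(2))
  have large: "n < dm (carrier L)" if "fin_dim (carrier L)"
    using assms(6) that by (simp add: ext_degree_def)
  let ?M = "{m - 1 - n mod m | m. m \<in> intermediate_degrees K \<and> m \<le> n}"
  have fin: "finite ?M" by (rule finite_subset[of _ "{..n}"]) auto
  \<comment> \<open>\<open>min_degree\<close> admits the whole field as a candidate. Since
    \<open>n\<close> is below its degree, the minimum is attained at a proper field, so
    \<open>?M\<close> is nonempty.\<close>
  let ?Q = "\<lambda>m. \<exists>F. subfield F L \<and> K \<subset> F \<and> F \<subseteq> carrier L \<and> dimension m K F"
  have "\<exists>m. ?Q m" using assms(4) unfolding finite_dimension_def by blast
  then have "?Q (min_degree K)" unfolding min_degree_def by (rule LeastI_ex)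
  then obtain F where F: "subfield F L" "K \<subset> F" "F \<subseteq> carrier L" "dimension (min_degree K) K F"
    by blast
  then have "F \<noteq> carrier L" using large assms(5) dimension_iff by fastforce
  then have "min_degree K \<in> intermediate_degrees K"
    using F unfolding intermediate_degrees_def by blast
  then have ne: "?M \<noteq> {}" using assms(5) by blast
  define D where "D = Max ?M"
  have D: "m - 1 - n mod m \<le> D" if "m \<in> intermediate_degrees K" "m \<le> n" for m
    unfolding D_def using that by (intro Max_ge[OF fin]) blast
  have "D \<in> ?M" unfolding D_def by (rule Max_in[OF fin ne])
  then obtain m where m: "m \<in> intermediate_degrees K" "m \<le> n" "D = m - 1 - n mod m" by blast
  have matched: "partially_matched K A B D"
    if "dimension n K A" "dimension n K B" "\<one>\<^bsub>L\<^esub> \<notin> B" for A B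
  proof (rule partially_matchedI)
    show "fin_dim A" "fin_dim B" "dm A = dm B" "D \<le> dm B" using that m dimension_iff by auto
    show "dm S + dm T \<le> dm B + D"
      if "subspace S" "subspace T" "S \<subseteq> A" "T \<subseteq> B" "\<And>s t. s \<in> S \<Longrightarrow> t \<in> T \<Longrightarrow> s \<otimes>\<^bsub>L\<^esub> t \<in> A" for S T
      using deficiency_bound[of A B n D S T] \<open>dimension n K A\<close> \<open>dimension n K B\<close> \<open>\<one>\<^bsub>L\<^esub> \<notin> B\<close> large D that
        dimension_iff by metis
  qed
  have le: "deficiency K A B \<le> D" if "dimension n K A" "dimension n K B" "\<one>\<^bsub>L\<^esub> \<notin> B" for A B
    unfolding deficiency_def by (rule Least_le[of "partially_matched K A B", OF matched[OF that]])
  obtain E where "subfield E L" "K \<subset> E" "E \<subset> carrier L" "dimension m K E"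
    using m(1) unfolding intermediate_degrees_def by blast
  from exists_extremal_pair[OF this m(2) large] obtain A B S T where
    AB: "fin_dim A" "fin_dim B" "dm A = n" "dm B = n" "\<one>\<^bsub>L\<^esub> \<notin> B" and
    ST: "subspace S" "subspace T" "S \<subseteq> A" "T \<subseteq> B" "\<forall>s\<in>S. \<forall>t\<in>T. s \<otimes>\<^bsub>L\<^esub> t \<in> A" and
    dims: "dm S + dm T = n + (m - 1 - n mod m)" by blast
  have AB': "dimension n K A" "dimension n K B" using AB dimension_iff by auto
  have "partially_matched K A B (deficiency K A B)"
    unfolding deficiency_def by (rule LeastI[of "partially_matched K A B", OF matched[OF AB' AB(5)]])
  \<comment> \<open>The deficiency is itself an admissible defect, so the extremal pair
    \<open>S\<close>, \<open>T\<close> forces it up to \<open>D\<close>.\<close>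
  from partially_matchedD[OF this AB(1,2) _ ST(1-4)] have "dm S + dm T \<le> n + deficiency K A B"
    using ST(5) AB(3,4) by simp
  then have eq: "deficiency K A B = D" using le[OF AB' AB(5)] dims m(3) by simp
  have "max_deficiency K n = D"
    unfolding max_deficiency_def
  proof (rule Max_eqI)
    show "finite {deficiency K A B |A B. dimension n K A \<and> dimension n K B \<and> \<one>\<^bsub>L\<^esub> \<notin> B}"
      by (rule finite_subset[of _ "{..D}"]) (use le in auto)
    show "D \<in> {deficiency K A B |A B. dimension n K A \<and> dimension n K B \<and> \<one>\<^bsub>L\<^esub> \<notin> B}"
      using eq AB' AB(5) by blast
  qed (use le in blast)
  then show ?thesis by (simp add: D_def)
qed

end
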